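(* Let $M$ be an $m$-dimensional closed manifold $(m\geq 1)$, and let $i : M\to \mathbb{R}^\ell$ $(m+1\leq \ell)$ be an embedding. Then there exist $p_1,\ldots,p_{m+1}\in i(M)$ and $p_{m+2},\ldots,p_\ell\in \mathbb{R}^\ell$ such that $d_{(p_1,\ldots,p_\ell)}\circ i : M\rightarrow \left(d_{(p_1,\ldots,p_\ell)}\circ i\right)(M)\subset \mathbb{R}^\ell$ is a homeomorphism.
   Context: Manifolds and embeddings are of class $C^\infty$. A closed manifold is a compact manifold without boundary. $d(x,y)=\sqrt{\sum_{j=1}^n(x_j-y_j)^2}$ is the Euclidean distance on $\mathbb{R}^n$. For points $p_1,\ldots,p_\ell\in\mathbb{R}^n$ ($\ell\ge1$), the distance mapping $d_{(p_1,\ldots,p_\ell)}:\mathbb{R}^n\to\mathbb{R}^\ell$ is defined by $d_{(p_1,\ldots,p_\ell)}(x)=(d(p_1,x),\ldots,d(p_\ell,x))$ (a continuous map, not necessarily differentiable). Here it is used with $n=\ell$. *)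

theory Defs
  imports "HOL-Analysis.Analysis"
begin

text \<open>Class \<open>C\<^sup>k\<close> and \<open>C\<^sup>\<infinity>\<close> on an open set: \<open>f\<close> is \<open>C\<^sup>k\<^sup>+\<^sup>1\<close> iff it is differentiable and,
  for every direction \<open>v\<close>, the directional derivative \<open>x \<mapsto> Df(x) v\<close> is \<open>C\<^sup>k\<close>.
  Only meant for open \<open>S\<close>, where the derivative depends on \<open>f\<close> restricted to \<open>S\<close> alone.\<close>

primrec Ck_on :: "nat \<Rightarrow> ('a::euclidean_space) set \<Rightarrow> ('a \<Rightarrow> 'b::euclidean_space) \<Rightarrow> bool" where
  "Ck_on 0 S f \<longleftrightarrow> continuous_on S f"
| "Ck_on (Suc k) S f \<longleftrightarrow>
     (\<forall>x\<in>S. f differentiable (at x)) \<and>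
     (\<forall>v. Ck_on k S (\<lambda>x. frechet_derivative f (at x) v))"

definition smooth_on :: "('a::euclidean_space) set \<Rightarrow> ('a \<Rightarrow> 'b::euclidean_space) \<Rightarrow> bool" where
  "smooth_on S f \<longleftrightarrow> (\<forall>k. Ck_on k S f)"

text \<open>A chart is a pair \<open>(U, \<phi>)\<close>; the values of \<open>\<phi>\<close> outside \<open>U\<close> are irrelevant.
  Dimension is \<open>CARD('m)\<close>. Chart images are open in \<open>\<real>\<^sup>m\<close>, so there is no boundary.
  Atlases are not required to be maximal: an atlas determines its maximal atlas, and
  smoothness and immersivity below do not depend on the choice of a compatible atlas.\<close>

type_synonym ('a, 'm) chart = "'a set \<times> ('a \<Rightarrow> real ^ 'm)"

definition is_chart :: "'a topology \<Rightarrow> ('a, 'm::finite) chart \<Rightarrow> bool" where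
  "is_chart X c \<longleftrightarrow> (case c of (U, \<phi>) \<Rightarrow>
     openin X U \<and> open (\<phi> ` U) \<and>
     homeomorphic_map (subtopology X U) (top_of_set (\<phi> ` U)) \<phi>)"

text \<open>The compatibility condition below is imposed on all ordered pairs, so each transition map
  and its inverse are smooth.\<close>

definition smooth_atlas :: "'a topology \<Rightarrow> ('a, 'm::finite) chart set \<Rightarrow> bool" where
  "smooth_atlas X A \<longleftrightarrow>
     (\<forall>c\<in>A. is_chart X c) \<and>
     (\<Union>(U, \<phi>)\<in>A. U) = topspace X \<and>
     (\<forall>(U, \<phi>)\<in>A. \<forall>(V, \<psi>)\<in>A. smooth_on (\<phi> ` (U \<inter> V)) (\<psi> \<circ> inv_into U \<phi>))"

definition smooth_manifold :: "'a topology \<Rightarrow> ('a, 'm::finite) chart set \<Rightarrow> bool" where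
  "smooth_manifold X A \<longleftrightarrow> Hausdorff_space X \<and> second_countable X \<and> smooth_atlas X A"

definition closed_manifold :: "'a topology \<Rightarrow> ('a, 'm::finite) chart set \<Rightarrow> bool" where
  "closed_manifold X A \<longleftrightarrow> smooth_manifold X A \<and> compact_space X"

definition smooth_map_on_manifold ::
    "('a, 'm::finite) chart set \<Rightarrow> ('a \<Rightarrow> real ^ 'n::finite) \<Rightarrow> bool" where
  "smooth_map_on_manifold A f \<longleftrightarrow> (\<forall>(U, \<phi>)\<in>A. smooth_on (\<phi> ` U) (f \<circ> inv_into U \<phi>))"

definition immersion ::
    "('a, 'm::finite) chart set \<Rightarrow> ('a \<Rightarrow> real ^ 'n::finite) \<Rightarrow> bool" where
  "immersion A f \<longleftrightarrow> smooth_map_on_manifold A f \<and>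
     (\<forall>(U, \<phi>)\<in>A. \<forall>y\<in>\<phi> ` U. inj (frechet_derivative (f \<circ> inv_into U \<phi>) (at y)))"

definition smooth_embedding ::
    "'a topology \<Rightarrow> ('a, 'm::finite) chart set \<Rightarrow> ('a \<Rightarrow> real ^ 'n::finite) \<Rightarrow> bool" where
  "smooth_embedding X A f \<longleftrightarrow> immersion A f \<and> embedding_map X euclidean f"

definition distance_mapping :: "('l::finite \<Rightarrow> real ^ 'n::finite) \<Rightarrow> real ^ 'n \<Rightarrow> real ^ 'l" where
  "distance_mapping p x = (\<chi> j. dist (p j) x)"

end

theory Submission
  imports Defs
begin

text \<open>
  The image \<open>K\<close> of the embedding lies in the smallest ball around a chosen centre \<open>c\<close> that contains
  it, and touches the boundary sphere at a point \<open>q\<close> of \<open>K\<close> farthest from \<open>c\<close>. Put \<open>n = q - c\<close> and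
  call \<open>n \<bullet> (q - x)\<close> the depth of \<open>x\<close>. All depths on \<open>K\<close> are nonnegative, and a point of \<open>K\<close> of
  small depth is near \<open>q\<close>, because \<open>\<bar>x - q\<bar>\<^sup>2\<close> is at most twice the depth. The centres
  \<open>p\<^sub>1, \<dots>, p\<^sub>\<ell>\<close> are chosen to be affinely independent points of one hyperplane \<open>H\<close> of constant small
  depth \<open>t\<close>, that is, to span \<open>H\<close>.

  Distances to points spanning \<open>H\<close> determine a point up to reflection in \<open>H\<close>. If \<open>x\<close> and \<open>y\<close> are
  distinct points of \<open>K\<close> with the same distances, they are mirror images, so their depths add up to
  \<open>2 t\<close>; being nonnegative, both depths are at most \<open>2 t\<close>, hence both points are near \<open>q\<close>. But the
  direction of a chord of \<open>K\<close> between points near \<open>q\<close> is nearly tangent to \<open>K\<close> at \<open>q\<close>, whereas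
  \<open>y - x\<close> is a multiple of \<open>n\<close>, which is normal to \<open>K\<close> at \<open>q\<close>. This contradiction gives injectivity,
  and an injective continuous map on a compact space is a homeomorphism onto its image.

  It remains to place \<open>m + 1\<close> of the centres in \<open>K\<close>, that is, to see that \<open>K \<inter> H\<close> has affine
  dimension at least \<open>m\<close>. Near \<open>q\<close> the set \<open>K \<inter> H\<close> is a small sphere-like hypersurface of \<open>K\<close>
  surrounding \<open>q\<close>: along each ray from \<open>q\<close> in a chart the depth grows continuously from \<open>0\<close> to more
  than \<open>t\<close>. If \<open>K \<inter> H\<close> had smaller dimension, the inner product with some nonzero tangent vector
  would be constant on it, and \<open>K \<inter> H\<close> would miss the ray along that vector or the opposite one.

  What makes ``nearly tangent'' precise is that a parametrization of class \<open>C\<^sup>1\<close> is strictly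
  differentiable at the preimage of \<open>q\<close>; that its derivative is injective keeps chords comparable in
  length to the difference of the parameters.
\<close>

section \<open>Strict differentiability\<close>

text \<open>The derivative approximates differences \<open>g x - g y\<close> for both points moving near \<open>u\<close>, not just
  for \<open>y = u\<close>: control of chords between two arbitrary nearby points is what injectivity needs.\<close>

definition has_strict_derivative ::
    "('b::real_normed_vector \<Rightarrow> 'a::real_normed_vector) \<Rightarrow> ('b \<Rightarrow> 'a) \<Rightarrow> 'b \<Rightarrow> bool" where
  "has_strict_derivative g D u \<longleftrightarrow> bounded_linear D \<and>
     (\<forall>\<epsilon>>0. \<exists>\<delta>>0. \<forall>x\<in>ball u \<delta>. \<forall>y\<in>ball u \<delta>. norm (g x - g y - D (x - y)) \<le> \<epsilon> * norm (x - y))"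

lemma has_strict_derivativeE:
  assumes "has_strict_derivative g D u" and "\<epsilon> > 0"
  obtains \<delta> where "\<delta> > 0"
    and "\<And>x y. x \<in> ball u \<delta> \<Longrightarrow> y \<in> ball u \<delta> \<Longrightarrow> norm (g x - g y - D (x - y)) \<le> \<epsilon> * norm (x - y)"
  using assms unfolding has_strict_derivative_def by meson

lemma has_strict_derivative_imp_has_derivative:
  assumes "has_strict_derivative g D u"
  shows "(g has_derivative D) (at u)"
  unfolding has_derivative_within_alt
proof (intro conjI allI impI)
  show "bounded_linear D" using assms by (simp add: has_strict_derivative_def)
  fix e :: real assume "e > 0"
  then obtain \<delta> where \<delta>: "\<delta> > 0"
    "\<And>x y. x \<in> ball u \<delta> \<Longrightarrow> y \<in> ball u \<delta> \<Longrightarrow> norm (g x - g y - D (x - y)) \<le> e * norm (x - y)"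
    using has_strict_derivativeE[OF assms] by blast
  then show "\<exists>d>0. \<forall>y\<in>UNIV. norm (y - u) < d \<longrightarrow> norm (g y - g u - D (y - u)) \<le> e * norm (y - u)"
    by (intro exI[of _ \<delta>]) (auto simp: dist_norm norm_minus_commute)
qed

text \<open>Directional derivatives along a basis depend continuously on the point, hence the operator norm
  of \<open>Df(x) - Df(u)\<close> is small near \<open>u\<close>; the mean value inequality for \<open>f - Df(u)\<close> then gives
  the estimate.\<close>

lemma Ck_on_1_imp_has_strict_derivative:
  fixes f :: "'b::euclidean_space \<Rightarrow> 'a::euclidean_space"
  assumes C1: "Ck_on 1 S f" and "open S" and "u \<in> S"
  shows "has_strict_derivative f (frechet_derivative f (at u)) u"
proof -
  define F where "F x = frechet_derivative f (at x)" for x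
  have der: "(f has_derivative F x) (at x)" if "x \<in> S" for x
    using C1 that by (simp add: F_def frechet_derivative_works)
  have cont: "continuous_on S (\<lambda>x. F x v)" for v
    using C1 by (simp add: F_def)
  have bl: "bounded_linear (F x)" if "x \<in> S" for x
    using der[OF that] by (rule has_derivative_bounded_linear)
  have "\<exists>\<delta>>0. \<forall>x\<in>ball u \<delta>. \<forall>y\<in>ball u \<delta>. norm (f x - f y - F u (x - y)) \<le> \<epsilon> * norm (x - y)"
    if "\<epsilon> > 0" for \<epsilon>
  proof -
    \<comment> \<open>The norm of an operator is at most the sum of its norms on the basis vectors.\<close>
    define \<eta> where "\<eta> = \<epsilon> / real DIM('b)"
    have "\<eta> > 0" using that by (simp add: \<eta>_def)
    have "\<forall>\<^sub>F x in at u. \<forall>b\<in>(Basis::'b set). dist (F x b) (F u b) < \<eta>"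
    proof (rule eventually_ball_finite)
      show "\<forall>b\<in>(Basis::'b set). \<forall>\<^sub>F x in at u. dist (F x b) (F u b) < \<eta>"
        using cont \<open>open S\<close> \<open>u \<in> S\<close> \<open>\<eta> > 0\<close>
        by (metis at_within_open continuous_on tendstoD)
    qed simp
    moreover have "\<forall>\<^sub>F x in at u. x \<in> S"
      using \<open>open S\<close> \<open>u \<in> S\<close> by (simp add: eventually_at_in_open')
    ultimately have "\<forall>\<^sub>F x in at u. x \<in> S \<and> (\<forall>b\<in>(Basis::'b set). dist (F x b) (F u b) < \<eta>)"
      by eventually_elim auto
    then obtain \<delta> where "\<delta> > 0"
      and \<delta>: "\<And>x. x \<noteq> u \<Longrightarrow> dist x u < \<delta> \<Longrightarrow> x \<in> S \<and> (\<forall>b\<in>(Basis::'b set). dist (F x b) (F u b) < \<eta>)"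
      unfolding eventually_at by auto
    have near: "x \<in> S" "\<And>b. b \<in> Basis \<Longrightarrow> norm (F x b - F u b) \<le> \<eta>" if "x \<in> ball u \<delta>" for x
      using \<delta>[of x] that \<open>u \<in> S\<close> \<open>\<eta> > 0\<close>
      by (cases "x = u"; force simp: dist_commute less_imp_le simp flip: dist_norm)+
    have on: "onorm (\<lambda>v. F x v - F u v) \<le> \<epsilon>" if x: "x \<in> ball u \<delta>" for x
    proof (rule onorm_le)
      fix v :: 'b
      have lin: "linear (\<lambda>v. F x v - F u v)"
        using bl[OF near(1)[OF x]] bl[OF \<open>u \<in> S\<close>] by (intro bounded_linear.linear bounded_linear_sub)
      have "F x v - F u v = (\<Sum>b\<in>Basis. (v \<bullet> b) *\<^sub>R (F x b - F u b))"
        using linear_sum[OF lin, of "\<lambda>b. (v \<bullet> b) *\<^sub>R b" Basis] linear_cmul[OF lin]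
        by (simp add: euclidean_representation)
      also have "norm \<dots> \<le> (\<Sum>b\<in>(Basis::'b set). norm v * \<eta>)"
        by (rule sum_norm_le) (auto intro!: mult_mono Basis_le_norm near[OF x])
      finally show "norm (F x v - F u v) \<le> \<epsilon> * norm v"
        by (simp add: \<eta>_def mult.commute)
    qed
    have "norm (f x - f y - F u (x - y)) \<le> \<epsilon> * norm (x - y)"
      if x: "x \<in> ball u \<delta>" and y: "y \<in> ball u \<delta>" for x y
    proof -
      have "norm ((f x - F u x) - (f y - F u y)) \<le> \<epsilon> * norm (x - y)"
      proof (rule differentiable_bound[OF _ _ on x y])
        fix z assume "z \<in> ball u \<delta>"
        then show "((\<lambda>x. f x - F u x) has_derivative (\<lambda>v. F z v - F u v)) (at z within ball u \<delta>)"
          using der[OF near(1)] bounded_linear_imp_has_derivative[OF bl[OF \<open>u \<in> S\<close>]]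
          by (intro has_derivative_diff) (auto intro: has_derivative_at_withinI)
      qed auto
      then show ?thesis
        by (simp add: linear_diff[OF bounded_linear.linear[OF bl[OF \<open>u \<in> S\<close>]]] algebra_simps)
    qed
    then show ?thesis using \<open>\<delta> > 0\<close> by blast
  qed
  then show ?thesis
    using bl[OF \<open>u \<in> S\<close>] unfolding has_strict_derivative_def F_def by blast
qed

section \<open>Geometry near a farthest point\<close>

lemma norm_power2_le_depth_of_farthest:
  fixes q c x :: "'a::real_inner"
  assumes "dist c x \<le> dist c q"
  shows "(norm (x - q))\<^sup>2 \<le> 2 * ((q - c) \<bullet> (q - x))"
proof -
  have "(norm (c - x))\<^sup>2 \<le> (norm (c - q))\<^sup>2"
    using assms by (simp add: dist_norm)
  then show ?thesis
    by (simp add: power2_norm_eq_inner inner_diff_left inner_diff_right inner_commute)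
qed

lemma strict_derivative_orthogonal_at_maximum:
  fixes g :: "'b::euclidean_space \<Rightarrow> 'a::euclidean_space"
  assumes "has_strict_derivative g D u"
    and "\<rho> > 0" and max: "\<And>y. y \<in> ball u \<rho> \<Longrightarrow> n \<bullet> g y \<le> n \<bullet> g u"
  shows "n \<bullet> D v = 0"
proof -
  have "((\<lambda>y. n \<bullet> g y) has_derivative (\<lambda>v. n \<bullet> D v)) (at u)"
    using has_strict_derivative_imp_has_derivative[OF assms(1)] by (rule has_derivative_inner_right)
  then have "(\<lambda>v. n \<bullet> D v) = (\<lambda>v. 0)"
    by (rule differential_zero_maxmin[rotated 2, where S = "ball u \<rho>"]) (use assms in auto)
  then show ?thesis by metis
qed

text \<open>If the level set had smaller dimension, its image under the adjoint of \<open>D\<close> would lie in a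
  hyperplane of the parameter space, with normal \<open>a\<close> say. Up to the sign of \<open>a\<close>, the vector \<open>D a\<close>
  then has nonpositive inner product with \<open>x - q\<close> for every \<open>x\<close> in the level set. But the image of
  the ray in direction \<open>a\<close> meets the level set, by the intermediate value theorem, at a point \<open>x\<close>
  where \<open>x - q\<close> is close to a positive multiple of \<open>D a\<close>. The bound \<open>T\<close> is uniform because
  strict differentiability bounds \<open>\<bar>g y - q\<bar>\<close> from below on a whole sphere around \<open>u\<close>.\<close>

lemma level_sets_near_farthest_point_aff_dim:
  fixes g :: "'b::euclidean_space \<Rightarrow> 'a::euclidean_space"
  assumes far: "\<And>x. x \<in> K \<Longrightarrow> dist c x \<le> dist c q"
    and strict: "has_strict_derivative g D u" and "inj D" and "g u = q"
    and "\<rho> > 0" and gK: "g ` ball u \<rho> \<subseteq> K" and cont: "continuous_on (ball u \<rho>) g"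
  obtains T where "T > 0"
    and "\<And>t. 0 < t \<Longrightarrow> t \<le> T \<Longrightarrow> int DIM('b) \<le> aff_dim (K \<inter> {x. (q - c) \<bullet> (q - x) = t})"
proof -
  have lin: "linear D"
    using strict by (simp add: has_strict_derivative_def bounded_linear.linear)
  obtain B where "B > 0" and B: "\<And>v. B * norm v \<le> norm (D v)"
    using linear_inj_bounded_below_pos[OF lin \<open>inj D\<close>] by blast
  have "B / 2 > 0" using \<open>B > 0\<close> by simp
  then obtain \<delta> where "\<delta> > 0" and \<delta>: "\<And>x y. x \<in> ball u \<delta> \<Longrightarrow> y \<in> ball u \<delta> \<Longrightarrow>
      norm (g x - g y - D (x - y)) \<le> B / 2 * norm (x - y)"
    by (rule has_strict_derivativeE[OF strict]) blast
  define r where "r = min \<delta> \<rho> / 2"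
  have r: "r > 0" "r < \<delta>" "r < \<rho>"
    using \<open>\<delta> > 0\<close> \<open>\<rho> > 0\<close> by (auto simp: r_def)
  define depth where "depth x = (q - c) \<bullet> (q - x)" for x
  define T where "T = (B / 2 * r)\<^sup>2 / 2"
  show thesis
  proof (rule that)
    show "T > 0" using \<open>B > 0\<close> r by (simp add: T_def)
    fix t :: real assume t: "0 < t" "t \<le> T"
    show "int DIM('b) \<le> aff_dim (K \<inter> {x. (q - c) \<bullet> (q - x) = t})"
    proof (rule ccontr)
      define S where "S = K \<inter> {x. depth x = t}"
      assume "\<not> ?thesis"
      then have "aff_dim (adjoint D ` S) < int DIM('b)"
        using aff_dim_linear_image_le[OF adjoint_linear[OF lin], of S] by (simp add: S_def depth_def)
      then obtain a0 b0 where "a0 \<noteq> 0" "adjoint D ` S \<subseteq> {w. a0 \<bullet> w = b0}"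
        using aff_lowdim_subset_hyperplane by blast
      then have plane0: "\<And>x. x \<in> S \<Longrightarrow> D a0 \<bullet> x = b0"
        using adjoint_works[OF lin, of a0] by force
      \<comment> \<open>Either side of the parallel hyperplane through \<open>q\<close> may contain the level set;
          the sign of \<open>a\<close> makes it the negative one.\<close>
      obtain a where "a \<noteq> 0" and plane: "\<And>x. x \<in> S \<Longrightarrow> D a \<bullet> (x - q) \<le> 0"
      proof (cases "b0 \<le> D a0 \<bullet> q")
        case True
        then show thesis using that[of a0] \<open>a0 \<noteq> 0\<close> plane0 by (auto simp: inner_diff_right)
      next
        case False
        then show thesis using that[of "- a0"] \<open>a0 \<noteq> 0\<close> plane0 linear_neg[OF lin, of a0]
          by (auto simp: inner_diff_right)
      qed
      define v where "v = a /\<^sub>R norm a"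
      have v: "norm v = 1" using \<open>a \<noteq> 0\<close> by (simp add: v_def)
      have inball: "u + s *\<^sub>R v \<in> ball u \<delta> \<inter> ball u \<rho>" if "0 \<le> s" "s \<le> r" for s
        using that r v by (auto simp: dist_norm)
      have appr: "norm (g (u + s *\<^sub>R v) - q - s *\<^sub>R D v) \<le> B / 2 * s" if "0 \<le> s" "s \<le> r" for s
        using \<delta>[of "u + s *\<^sub>R v" u] inball[OF that] that v \<open>\<delta> > 0\<close> \<open>g u = q\<close>
        by (simp add: linear_cmul[OF lin])
      have "B / 2 * r \<le> norm (g (u + r *\<^sub>R v) - q)"
      proof -
        have "B * r \<le> norm (r *\<^sub>R D v)" using B[of v] v r by (simp add: mult.commute)
        then show ?thesis using appr[of r] r
          by (smt (verit) field_sum_of_halves mult_right_mono norm_minus_commute norm_triangle_sub distrib_right)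
      qed
      then have "(B / 2 * r)\<^sup>2 \<le> (norm (g (u + r *\<^sub>R v) - q))\<^sup>2"
        using \<open>B > 0\<close> r by (intro power_mono) auto
      also have "\<dots> \<le> 2 * depth (g (u + r *\<^sub>R v))"
        unfolding depth_def
        by (rule norm_power2_le_depth_of_farthest[OF far]) (use gK inball[of r] r in auto)
      finally have "T \<le> depth (g (u + r *\<^sub>R v))" by (simp add: T_def)
      moreover have "continuous_on {0..r} (\<lambda>s. depth (g (u + s *\<^sub>R v)))"
        unfolding depth_def using inball
        by (intro continuous_intros continuous_on_compose2[OF cont]) auto
      moreover have "depth (g (u + 0 *\<^sub>R v)) = 0" by (simp add: depth_def \<open>g u = q\<close>)
      ultimately obtain s where s: "0 \<le> s" "s \<le> r" "depth (g (u + s *\<^sub>R v)) = t"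
        using IVT'[of "\<lambda>s. depth (g (u + s *\<^sub>R v))" 0 t r] t r by auto
      have "s \<noteq> 0" using s(3) t \<open>g u = q\<close> by (auto simp: depth_def)
      have "g (u + s *\<^sub>R v) \<in> S" using s gK inball[of s] by (auto simp: S_def)
      then have "D a \<bullet> (g (u + s *\<^sub>R v) - q) \<le> 0" by (rule plane)
      moreover have "D a = norm a *\<^sub>R D v"
        using \<open>a \<noteq> 0\<close> by (simp add: v_def linear_cmul[OF lin])
      ultimately have neg: "D v \<bullet> (g (u + s *\<^sub>R v) - q) \<le> 0"
        using \<open>a \<noteq> 0\<close> by (simp add: mult_le_0_iff)
      have "s * (norm (D v))\<^sup>2 = D v \<bullet> (g (u + s *\<^sub>R v) - q)
          - D v \<bullet> (g (u + s *\<^sub>R v) - q - s *\<^sub>R D v)"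
        by (simp add: power2_norm_eq_inner inner_diff_right)
      also have "\<dots> \<le> norm (D v) * (B / 2 * s)"
        using neg Cauchy_Schwarz_ineq2[of "D v" "g (u + s *\<^sub>R v) - q - s *\<^sub>R D v"]
          mult_left_mono[OF appr[OF s(1,2)], of "norm (D v)"] by simp
      finally have "(s * norm (D v)) * norm (D v) \<le> (s * norm (D v)) * (B / 2)"
        by (simp add: power2_eq_square mult_ac)
      moreover have "0 < s * norm (D v)"
        using \<open>s \<noteq> 0\<close> s(1) B[of v] \<open>B > 0\<close> v by (intro mult_pos_pos) auto
      ultimately have "norm (D v) \<le> B / 2" by (simp only: mult_le_cancel_left_pos)
      then show False using B[of v] v \<open>B > 0\<close> by simp
    qed
  qed
qed

text \<open>The points equidistant from \<open>x\<close> and \<open>y\<close> form a hyperplane; if it contains the given one, the two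
  agree, so \<open>y - x\<close> is normal to it. The sum says that the midpoint lies on the hyperplane.\<close>

lemma equidistant_from_hyperplane_imp_reflected:
  fixes n :: "'a::real_inner"
  assumes "n \<noteq> 0" and "x \<noteq> y"
    and eq: "\<And>z. n \<bullet> (q - z) = t \<Longrightarrow> dist z x = dist z y"
  obtains k where "y - x = k *\<^sub>R n" and "n \<bullet> (q - x) + n \<bullet> (q - y) = 2 * t"
proof -
  have nn: "n \<bullet> n > 0" using \<open>n \<noteq> 0\<close> by simp
  \<comment> \<open>The foot of the perpendicular from \<open>x\<close> is \<open>x + s *\<^sub>R n\<close>; the part of \<open>y - x\<close> parallel to the
      hyperplane is \<open>w\<close>, and testing with the foot and its translate by \<open>w\<close> shows that \<open>w = 0\<close>.\<close>
  define s where "s = (n \<bullet> (q - x) - t) / (n \<bullet> n)"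
  define w where "w = (y - x) - ((y - x) \<bullet> n / (n \<bullet> n)) *\<^sub>R n"
  have nw: "n \<bullet> w = 0"
    using nn by (simp add: w_def inner_diff_right inner_commute)
  have s: "s * (n \<bullet> n) = n \<bullet> (q - x) - t" using nn by (simp add: s_def)
  have sq: "(z - x) \<bullet> (z - x) = (z - y) \<bullet> (z - y)" if "n \<bullet> (q - z) = t" for z
    using eq[OF that] by (simp add: dist_norm norm_eq)
  have on: "n \<bullet> (q - (x + s *\<^sub>R n)) = t" "n \<bullet> (q - (x + s *\<^sub>R n + w)) = t"
    using s nw by (simp_all add: inner_diff_right inner_add_right)
  have "w \<bullet> (y - x) = 0"
    using sq[OF on(1)] sq[OF on(2)]
    by (simp add: inner_diff_left inner_diff_right inner_add_left inner_add_right inner_commute)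
  then have "w \<bullet> w = 0"
    using nw by (simp add: w_def inner_diff_right inner_commute)
  then obtain k where k: "y - x = k *\<^sub>R n" unfolding w_def by auto
  then have y: "y = x + k *\<^sub>R n" by (simp add: algebra_simps)
  have "k \<noteq> 0" using k \<open>x \<noteq> y\<close> by auto
  have "s\<^sup>2 * (n \<bullet> n) = (s - k)\<^sup>2 * (n \<bullet> n)"
    using sq[OF on(1)] by (simp add: y power2_eq_square algebra_simps inner_simps)
  then have "s\<^sup>2 = (s - k)\<^sup>2" using nn by simp
  then have "k = 2 * s" using \<open>k \<noteq> 0\<close> by (simp add: power2_eq_iff)
  then have "n \<bullet> (q - x) + n \<bullet> (q - y) = 2 * t"
    using s by (simp add: y inner_simps algebra_simps)
  with k show thesis by (rule that)
qed

text \<open>Two points of \<open>K\<close> with equal distances would be joined by a chord parallel to the normal \<open>q - c\<close>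
  while both lie so close to \<open>q\<close> that chords are nearly tangent. The assumption on neighbourhoods makes
  every point of \<open>K\<close> near \<open>q\<close> a value of the parametrization near \<open>u\<close>, which excludes
  other sheets of \<open>K\<close> passing close to \<open>q\<close>.\<close>

lemma distances_to_hyperplane_separate_near_farthest_point:
  fixes g :: "'b::euclidean_space \<Rightarrow> 'a::euclidean_space"
  assumes far: "\<And>x. x \<in> K \<Longrightarrow> dist c x \<le> dist c q" and "q \<noteq> c"
    and strict: "has_strict_derivative g D u" and "inj D" and "g u = q"
    and "\<rho> > 0" and gK: "g ` ball u \<rho> \<subseteq> K"
    and nbhd: "\<And>\<delta>. \<delta> > 0 \<Longrightarrow> \<exists>\<eta>>0. K \<inter> ball q \<eta> \<subseteq> g ` ball u \<delta>"
  obtains T where "T > 0"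
    and "\<And>t x y. \<lbrakk>0 < t; t \<le> T; x \<in> K; y \<in> K;
           \<And>z. (q - c) \<bullet> (q - z) = t \<Longrightarrow> dist z x = dist z y\<rbrakk> \<Longrightarrow> x = y"
proof -
  define n where "n = q - c"
  have "n \<noteq> 0" using \<open>q \<noteq> c\<close> by (simp add: n_def)
  have depth: "(norm (x - q))\<^sup>2 \<le> 2 * (n \<bullet> (q - x))" if "x \<in> K" for x
    unfolding n_def by (rule norm_power2_le_depth_of_farthest[OF far[OF that]])
  have lin: "linear D"
    using strict by (simp add: has_strict_derivative_def bounded_linear.linear)
  obtain B where "B > 0" and B: "\<And>v. B * norm v \<le> norm (D v)"
    using linear_inj_bounded_below_pos[OF lin \<open>inj D\<close>] by blast
  have normal: "n \<bullet> D v = 0" for v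
  proof (rule strict_derivative_orthogonal_at_maximum[OF strict \<open>\<rho> > 0\<close>])
    fix y assume "y \<in> ball u \<rho>"
    then have "g y \<in> K" using gK by blast
    then have "0 \<le> n \<bullet> (q - g y)"
      using depth[of "g y"] zero_le_power2[of "norm (g y - q)"] by linarith
    then show "n \<bullet> g y \<le> n \<bullet> g u" by (simp add: inner_diff_right \<open>g u = q\<close>)
  qed
  have "B / 4 > 0" using \<open>B > 0\<close> by simp
  then obtain \<delta> where "\<delta> > 0" and \<delta>: "\<And>x y. x \<in> ball u \<delta> \<Longrightarrow> y \<in> ball u \<delta> \<Longrightarrow>
      norm (g x - g y - D (x - y)) \<le> B / 4 * norm (x - y)"
    by (rule has_strict_derivativeE[OF strict]) blast
  obtain \<eta> where "\<eta> > 0" and \<eta>: "K \<inter> ball q \<eta> \<subseteq> g ` ball u \<delta>"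
    using nbhd[OF \<open>\<delta> > 0\<close>] by blast
  show thesis
  proof (rule that)
    \<comment> \<open>Depth at most \<open>2 * t\<close> bounds the squared distance to \<open>q\<close> by \<open>4 * t\<close>, which is then at most
        \<open>\<eta>\<^sup>2 / 2\<close>.\<close>
    show "\<eta>\<^sup>2 / 8 > 0" using \<open>\<eta> > 0\<close> by simp
    fix t x y
    assume t: "0 < t" "t \<le> \<eta>\<^sup>2 / 8" and xy: "x \<in> K" "y \<in> K"
      and eq: "\<And>z. (q - c) \<bullet> (q - z) = t \<Longrightarrow> dist z x = dist z y"
    show "x = y"
    proof (rule ccontr)
      assume "x \<noteq> y"
      then obtain k where k: "y - x = k *\<^sub>R n" and sum: "n \<bullet> (q - x) + n \<bullet> (q - y) = 2 * t"
        using equidistant_from_hyperplane_imp_reflected[OF \<open>n \<noteq> 0\<close> \<open>x \<noteq> y\<close>] eq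
        unfolding n_def by blast
      have "z \<in> g ` ball u \<delta>" if "z \<in> K" "n \<bullet> (q - z) \<le> 2 * t" for z
      proof -
        have "(norm (z - q))\<^sup>2 < \<eta>\<^sup>2"
          using depth[OF that(1)] that(2) t zero_less_power[OF \<open>\<eta> > 0\<close>, of 2] by linarith
        then have "norm (z - q) < \<eta>" using \<open>\<eta> > 0\<close> by (simp add: power2_less_imp_less)
        then show ?thesis using \<eta> that(1) by (auto simp: dist_norm norm_minus_commute)
      qed
      moreover have "0 \<le> n \<bullet> (q - z)" if "z \<in> K" for z
        using depth[OF that] zero_le_power2[of "norm (z - q)"] by linarith
      ultimately have "x \<in> g ` ball u \<delta>" "y \<in> g ` ball u \<delta>"
        using xy sum by (smt (verit))+
      then obtain a b where ab: "a \<in> ball u \<delta>" "b \<in> ball u \<delta>" "x = g a" "y = g b" by blast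
      \<comment> \<open>Since \<open>n\<close> is orthogonal to the tangent part \<open>D (b - a)\<close>, the chord \<open>y - x\<close>, a multiple of
          \<open>n\<close>, is no longer than the error term \<open>d\<close>.\<close>
      define d where "d = y - x - D (b - a)"
      have d: "norm d \<le> B / 4 * norm (b - a)" using \<delta>[of b a] ab by (simp add: d_def)
      have "n \<bullet> (y - x) = n \<bullet> d" by (simp add: d_def inner_diff_right normal)
      then have "\<bar>n \<bullet> (y - x)\<bar> \<le> norm n * norm d" by (simp add: Cauchy_Schwarz_ineq2)
      moreover have "\<bar>n \<bullet> (y - x)\<bar> = norm n * norm (y - x)"
        by (simp add: k abs_mult power2_eq_square flip: power2_norm_eq_inner)
      ultimately have "norm (y - x) \<le> norm d" using \<open>n \<noteq> 0\<close> by simp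
      moreover have "B * norm (b - a) \<le> norm (y - x) + norm d"
        using B[of "b - a"] norm_triangle_ineq4[of "y - x" d] by (simp add: d_def)
      ultimately have "B * norm (b - a) \<le> 2 * (B / 4 * norm (b - a))" using d by linarith
      then have "B * norm (b - a) \<le> 0" by simp
      then have "b = a" using \<open>B > 0\<close> by (simp add: mult_le_0_iff)
      then show False using ab \<open>x \<noteq> y\<close> by simp
    qed
  qed
qed


section \<open>Choice of the centres\<close>

text \<open>The points equidistant from \<open>x\<close> and \<open>y\<close> satisfy one affine equation.\<close>

lemma affine_hull_equidistant:
  fixes x y z :: "'a::euclidean_space"
  assumes "\<And>b. b \<in> B \<Longrightarrow> dist b x = dist b y" and "z \<in> affine hull B"
  shows "dist z x = dist z y"
proof -
  have "dist b x = dist b y \<longleftrightarrow> b \<in> {w. (2 *\<^sub>R (y - x)) \<bullet> w = y \<bullet> y - x \<bullet> x}" for b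
    by (simp add: dist_norm norm_eq inner_simps inner_commute) argo
  then show ?thesis
    using assms hull_minimal[of B "{w. (2 *\<^sub>R (y - x)) \<bullet> w = y \<bullet> y - x \<bullet> x}" affine]
      affine_hyperplane by blast
qed

text \<open>At a depth small enough for both the dimension estimate and the separation property, the set \<open>C\<close>
  consists of affinely independent points of \<open>K\<close> at that depth, and \<open>B\<close> completes it to an affine
  basis of the hyperplane of that depth.\<close>

proposition exists_separating_distance_centres:
  fixes g :: "'b::euclidean_space \<Rightarrow> 'a::euclidean_space"
  assumes far: "\<And>x. x \<in> K \<Longrightarrow> dist c x \<le> dist c q" and "q \<noteq> c"
    and strict: "has_strict_derivative g D u" and "inj D" and "g u = q"
    and "\<rho> > 0" and gK: "g ` ball u \<rho> \<subseteq> K" and cont: "continuous_on (ball u \<rho>) g"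
    and nbhd: "\<And>\<delta>. \<delta> > 0 \<Longrightarrow> \<exists>\<eta>>0. K \<inter> ball q \<eta> \<subseteq> g ` ball u \<delta>"
  obtains B C where "C \<subseteq> B" "C \<subseteq> K" "card C = DIM('b) + 1" "card B = DIM('a)"
    and "\<And>x y. \<lbrakk>x \<in> K; y \<in> K; \<And>z. z \<in> B \<Longrightarrow> dist z x = dist z y\<rbrakk> \<Longrightarrow> x = y"
proof -
  obtain T1 where T1: "T1 > 0"
    "\<And>t. 0 < t \<Longrightarrow> t \<le> T1 \<Longrightarrow> int DIM('b) \<le> aff_dim (K \<inter> {x. (q - c) \<bullet> (q - x) = t})"
    by (rule level_sets_near_farthest_point_aff_dim[OF far strict \<open>inj D\<close> \<open>g u = q\<close> \<open>\<rho> > 0\<close> gK cont]) blast+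
  obtain T2 where T2: "T2 > 0"
    "\<And>t x y. \<lbrakk>0 < t; t \<le> T2; x \<in> K; y \<in> K;
           \<And>z. (q - c) \<bullet> (q - z) = t \<Longrightarrow> dist z x = dist z y\<rbrakk> \<Longrightarrow> x = y"
    by (rule distances_to_hyperplane_separate_near_farthest_point
        [OF far \<open>q \<noteq> c\<close> strict \<open>inj D\<close> \<open>g u = q\<close> \<open>\<rho> > 0\<close> gK nbhd]) blast+
  define t where "t = min T1 T2"
  have t: "0 < t" "t \<le> T1" "t \<le> T2" using T1(1) T2(1) by (auto simp: t_def)
  define H where "H = {x. (q - c) \<bullet> (q - x) = t}"
  have H: "H = {x. (q - c) \<bullet> x = (q - c) \<bullet> q - t}"
    by (auto simp: H_def inner_diff_right)
  obtain C0 where C0: "C0 \<subseteq> K \<inter> H" "\<not> affine_dependent C0" "affine hull (K \<inter> H) = affine hull C0"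
    using affine_basis_exists by blast
  have "int DIM('b) \<le> aff_dim C0"
    using T1(2)[OF t(1,2)] C0(3) by (metis H_def aff_dim_affine_hull)
  then have "DIM('b) + 1 \<le> card C0"
    using aff_dim_affine_independent[OF C0(2)] by linarith
  then obtain C where C: "C \<subseteq> C0" "card C = DIM('b) + 1"
    using obtain_subset_with_card_n by metis
  have "\<not> affine_dependent C" "C \<subseteq> H"
    using affine_independent_subset[OF C0(2) C(1)] C C0(1) by auto
  then obtain B where B: "\<not> affine_dependent B" "C \<subseteq> B" "B \<subseteq> H" "affine hull B = affine hull H"
    using extend_to_affine_basis by metis
  have hull: "affine hull B = H" using B(4) by (simp add: H affine_hull_eq affine_hyperplane)
  have "aff_dim B = int DIM('a) - 1"
    using \<open>q \<noteq> c\<close> aff_dim_hyperplane[of "q - c"] aff_dim_affine_hull[of B]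
    unfolding hull H by simp
  then have "card B = DIM('a)" using aff_dim_affine_independent[OF B(1)] by linarith
  moreover have "x = y" if "x \<in> K" "y \<in> K" "\<And>z. z \<in> B \<Longrightarrow> dist z x = dist z y" for x y
    using T2(2)[OF t(1,3) that(1,2)] affine_hull_equidistant[OF that(3)] hull by (auto simp: H_def)
  ultimately show thesis using that B(2) C C0(1) by blast
qed

section \<open>Embedded manifolds\<close>

text \<open>The inverse of a chart composed with the embedding. Small pieces of its image are relatively open in
  the image of \<open>M\<close> because \<open>i\<close> is a homeomorphism onto its image; an injective immersion alone
  could accumulate on itself.\<close>

lemma embedded_manifold_strict_parametrization:
  fixes M :: "'a topology" and A :: "('a, 'm::finite) chart set" and i :: "'a \<Rightarrow> real ^ 'n::finite"
  assumes "smooth_manifold M A" and emb: "smooth_embedding M A i" and "x0 \<in> topspace M"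
  obtains g :: "real ^ 'm \<Rightarrow> real ^ 'n" and D u \<rho>
  where "has_strict_derivative g D u" "inj D" "g u = i x0" "\<rho> > 0"
    "g ` ball u \<rho> \<subseteq> i ` topspace M" "continuous_on (ball u \<rho>) g"
    "\<And>\<delta>. \<delta> > 0 \<Longrightarrow> \<exists>\<eta>>0. i ` topspace M \<inter> ball (i x0) \<eta> \<subseteq> g ` ball u \<delta>"
proof -
  have atlas: "smooth_atlas M A" using assms by (simp add: smooth_manifold_def)
  then obtain U \<phi> where UA: "(U, \<phi>) \<in> A" and "x0 \<in> U"
    using \<open>x0 \<in> topspace M\<close> unfolding smooth_atlas_def by blast
  have "is_chart M (U, \<phi>)" using atlas UA unfolding smooth_atlas_def by blast
  then have U: "openin M U" and op: "open (\<phi> ` U)"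
    and hom: "homeomorphic_map (subtopology M U) (top_of_set (\<phi> ` U)) \<phi>"
    by (auto simp: is_chart_def)
  have topU: "topspace (subtopology M U) = U"
    using openin_subset[OF U] by auto
  have inj: "inj_on \<phi> U"
    using homeomorphic_imp_injective_map[OF hom] topU by simp
  define g where "g = i \<circ> inv_into U \<phi>"
  define u where "u = \<phi> x0"
  have u: "u \<in> \<phi> ` U" using \<open>x0 \<in> U\<close> by (simp add: u_def)
  have g\<phi>: "g (\<phi> x) = i x" if "x \<in> U" for x
    using that inj by (simp add: g_def)
  have imm: "immersion A i" and iemb: "embedding_map M euclidean i"
    using emb by (auto simp: smooth_embedding_def)
  have "smooth_on (\<phi> ` U) g"
    using imm UA unfolding immersion_def smooth_map_on_manifold_def g_def by blast
  then have Ck: "Ck_on 0 (\<phi> ` U) g" "Ck_on 1 (\<phi> ` U) g"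
    unfolding smooth_on_def by blast+
  obtain \<rho> where "\<rho> > 0" and \<rho>: "ball u \<rho> \<subseteq> \<phi> ` U"
    using op u by (auto simp: open_contains_ball)
  show thesis
  proof (rule that)
    show "has_strict_derivative g (frechet_derivative g (at u)) u"
      by (rule Ck_on_1_imp_has_strict_derivative[OF Ck(2) op u])
    show "inj (frechet_derivative g (at u))"
      using imm UA u unfolding immersion_def g_def by blast
    show "g u = i x0" using g\<phi>[OF \<open>x0 \<in> U\<close>] by (simp add: u_def)
    show "\<rho> > 0" by fact
    show "g ` ball u \<rho> \<subseteq> i ` topspace M"
      using \<rho> g\<phi> openin_subset[OF U] by fastforce
    show "continuous_on (ball u \<rho>) g"
      using Ck(1) \<rho> by (auto intro: continuous_on_subset)
    fix \<delta> :: real assume "\<delta> > 0"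
    define W where "W = {x \<in> U. \<phi> x \<in> ball u \<delta>}"
    have "openin (subtopology M U) {x \<in> topspace (subtopology M U). \<phi> x \<in> \<phi> ` U \<inter> ball u \<delta>}"
      by (rule openin_continuous_map_preimage[OF homeomorphic_imp_continuous_map[OF hom]])
         (simp add: openin_open_Int)
    also have "{x \<in> topspace (subtopology M U). \<phi> x \<in> \<phi> ` U \<inter> ball u \<delta>} = W"
      unfolding topU W_def by blast
    finally have "openin (subtopology M U) W" .
    then have "openin M W" using U by (simp add: openin_open_subtopology)
    then have "openin (top_of_set (i ` topspace M)) (i ` W)"
      using iemb homeomorphic_imp_open_map unfolding embedding_map_def open_map_def by blast
    then obtain O' where O': "open O'" "i ` W = i ` topspace M \<inter> O'"
      by (auto simp: openin_open)
    have "x0 \<in> W" using \<open>x0 \<in> U\<close> \<open>\<delta> > 0\<close> by (simp add: W_def u_def)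
    then obtain \<eta> where "\<eta> > 0" and "ball (i x0) \<eta> \<subseteq> O'"
      using O' by (metis IntD2 imageI open_contains_ball)
    have "i ` W \<subseteq> g ` ball u \<delta>"
      by (auto simp: W_def simp flip: g\<phi>)
    then have "i ` topspace M \<inter> ball (i x0) \<eta> \<subseteq> g ` ball u \<delta>"
      using O'(2) \<open>ball (i x0) \<eta> \<subseteq> O'\<close> by auto
    then show "\<exists>\<eta>>0. i ` topspace M \<inter> ball (i x0) \<eta> \<subseteq> g ` ball u \<delta>"
      using \<open>\<eta> > 0\<close> by blast
  qed
qed

lemma exists_bij_betw_extending_subset:
  assumes "finite S" "finite B" "card S = card B" "S' \<subseteq> S" "B' \<subseteq> B" "card S' = card B'"
  obtains p where "bij_betw p S B" "p ` S' = B'"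
proof -
  have "finite S'" "finite B'" using assms finite_subset by blast+
  then obtain f where f: "bij_betw f S' B'"
    using assms(6) finite_same_card_bij by blast
  have "card (S - S') = card (B - B')"
    using assms \<open>finite S'\<close> \<open>finite B'\<close> by (simp add: card_Diff_subset)
  then obtain h where h: "bij_betw h (S - S') (B - B')"
    using assms finite_same_card_bij by (metis finite_Diff)
  define p where "p x = (if x \<in> S' then f x else h x)" for x
  have p': "bij_betw p S' B'" "bij_betw p (S - S') (B - B')"
    using f h bij_betw_cong[of S' f p] bij_betw_cong[of "S - S'" h p] by (auto simp: p_def)
  have "bij_betw p (S' \<union> (S - S')) (B' \<union> (B - B'))"
    by (rule bij_betw_combine[OF p']) auto
  moreover have "S' \<union> (S - S') = S" "B' \<union> (B - B') = B" using assms by auto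
  ultimately show thesis using that p'(1) bij_betw_imp_surj_on by metis
qed

theorem corollary1p2:
  fixes M :: "'a topology"
    and A :: "('a, 'm::finite) chart set"
    and i :: "'a \<Rightarrow> real ^ 'l::finite"
    and e :: "nat \<Rightarrow> 'l"
  assumes "closed_manifold M A"
    and "topspace M \<noteq> {}"
    and "CARD('m) + 1 \<le> CARD('l)"
    and "smooth_embedding M A i"
    and "bij_betw e {1..CARD('l)} UNIV"
  shows "\<exists>p :: 'l \<Rightarrow> real ^ 'l.
           (\<forall>k\<in>{1..CARD('m) + 1}. p (e k) \<in> i ` topspace M) \<and>
           homeomorphic_map M
             (top_of_set ((distance_mapping p \<circ> i) ` topspace M))
             (distance_mapping p \<circ> i)"
proof -
  define K where "K = i ` topspace M"
  have man: "smooth_manifold M A" and cpt: "compact_space M"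
    using assms(1) by (auto simp: closed_manifold_def)
  have emb: "embedding_map M euclidean i" using assms(4) by (simp add: smooth_embedding_def)
  then have cont: "continuous_map M euclidean i" and inj: "inj_on i (topspace M)"
    unfolding embedding_map_def
    by (auto dest: homeomorphic_imp_continuous_map homeomorphic_imp_injective_map
        simp: continuous_map_in_subtopology)
  have "compact K"
    using image_compactin[OF _ cont] cpt by (auto simp: K_def compact_space_def)
  obtain x1 where "x1 \<in> topspace M" using assms(2) by blast
  \<comment> \<open>Any centre different from some point of \<open>K\<close> does; this keeps the farthest point away from it,
      so that \<open>q - c\<close> is a genuine normal vector.\<close>
  define c :: "real ^ 'l" where "c = i x1 + (\<chi> j. 1)"
  have "c \<noteq> i x1" by (simp add: c_def vec_eq_iff)
  obtain q where "q \<in> K" and far: "\<And>x. x \<in> K \<Longrightarrow> dist c x \<le> dist c q"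
    using distance_attains_sup[OF \<open>compact K\<close>, of c] assms(2) unfolding K_def by blast
  have "q \<noteq> c"
    using far[of "i x1"] \<open>c \<noteq> i x1\<close> \<open>x1 \<in> topspace M\<close> by (auto simp: K_def)
  obtain x0 where x0: "x0 \<in> topspace M" "q = i x0" using \<open>q \<in> K\<close> by (auto simp: K_def)
  obtain g D u \<rho> where g: "has_strict_derivative (g :: real ^ 'm \<Rightarrow> real ^ 'l) D u" "inj D" "g u = q" "\<rho> > 0"
    "g ` ball u \<rho> \<subseteq> K" "continuous_on (ball u \<rho>) g"
    "\<And>\<delta>. \<delta> > 0 \<Longrightarrow> \<exists>\<eta>>0. K \<inter> ball q \<eta> \<subseteq> g ` ball u \<delta>"
    using embedded_manifold_strict_parametrization[OF man assms(4) x0(1)]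
    unfolding x0(2) K_def by blast
  obtain B C where BC: "C \<subseteq> B" "C \<subseteq> K" "card C = DIM(real ^ 'm) + 1" "card B = DIM(real ^ 'l)"
    and sep: "\<And>x y. \<lbrakk>x \<in> K; y \<in> K; \<And>z. z \<in> B \<Longrightarrow> dist z x = dist z y\<rbrakk> \<Longrightarrow> x = y"
    by (rule exists_separating_distance_centres[OF far \<open>q \<noteq> c\<close> g]) blast+
  define S' where "S' = e ` {1..CARD('m) + 1}"
  have "inj_on e {1..CARD('m) + 1}"
    using assms(3,5) by (auto simp: bij_betw_def intro: inj_on_subset)
  then have "card S' = card C"
    using BC(3) by (simp add: S'_def card_image)
  moreover have "card (UNIV :: 'l set) = card B" using BC(4) by simp
  moreover have "finite B" using BC(4) by (simp add: card_ge_0_finite)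
  ultimately obtain p where p: "bij_betw p (UNIV :: 'l set) B" "p ` S' = C"
    using exists_bij_betw_extending_subset[of "UNIV :: 'l set" B S' C] BC(1) by auto
  have "continuous_on UNIV (distance_mapping p)"
    unfolding distance_mapping_def by (intro continuous_intros)
  then have dcont: "continuous_map M euclidean (distance_mapping p \<circ> i)"
    by (intro continuous_map_compose[OF cont]) simp
  have "inj_on (distance_mapping p \<circ> i) (topspace M)"
  proof (rule inj_onI)
    fix x y assume xy: "x \<in> topspace M" "y \<in> topspace M"
      and eq: "(distance_mapping p \<circ> i) x = (distance_mapping p \<circ> i) y"
    have "dist z (i x) = dist z (i y)" if "z \<in> B" for z
    proof -
      have "z \<in> range p" using that p(1) unfolding bij_betw_def by blast
      then show ?thesis using eq by (auto simp: distance_mapping_def vec_eq_iff)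
    qed
    then have "i x = i y" using sep xy by (simp add: K_def)
    then show "x = y" using inj xy by (simp add: inj_on_eq_iff)
  qed
  then have "homeomorphic_map M (top_of_set ((distance_mapping p \<circ> i) ` topspace M))
      (distance_mapping p \<circ> i)"
    using dcont cpt
    by (intro continuous_imp_homeomorphic_map)
       (auto simp: continuous_map_in_subtopology Hausdorff_space_subtopology
          Hausdorff_space_euclidean)
  moreover have "\<forall>k\<in>{1..CARD('m) + 1}. p (e k) \<in> i ` topspace M"
    using p(2) BC(2) unfolding S'_def K_def by blast
  ultimately show ?thesis by blast
qed

end
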